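(* For every integer $n\ge 1$, let $G_n$ be the graph of $V$'s in the complete binary tree $T_n$ (defined in the context). Then the path-chromatic number of $G_n$ is at most $2$, i.e. $\operatorname{pchr}(G_n)\le 2$.
   Context: The complete binary tree $T_n$ has as vertices all binary strings of length at most $n$ (including the empty string, the root); as a graph, $x$ is adjacent to $x0$ and $x1$. Write $x<y$ if $x$ is a proper initial segment of $y$. A $V$ in $T_n$ is a path in $T_n$ between two distinct vertices $y,z$ such that the vertex of the path closest to the root lies strictly between $y$ and $z$ on the path; this vertex $x$ is the low point of the $V$. Equivalently, a $V$ is determined by a triple $(x,y,z)$ of strings with $x0$ an initial segment of $y$ and $x1$ an initial segment of $z$; its endpoints are $y,z$ and its low point is $x$. The graph $G_n$ has as vertex set all $V$'s in $T_n$, two $V$'s being adjacent when an endpoint of one of them is the low point of the other. A path-decomposition of a graph $G$ is a path $P$ together with subsets (bags) $B_t\subseteq V(G)$, $t\in V(P)$, such that every vertex of $G$ lies in some bag, both ends of every edge lie together in some bag, and for each vertex $v$ of $G$ the set of $t$ with $v\in B_t$ induces a connected subpath of $P$. The chromatic number of a path-decomposition is the maximum over $t$ of the chromatic number of the subgraph of $G$ induced by $B_t$; the path-chromatic number $\operatorname{pchr}(G)$ is the minimum chromatic number of a path-decomposition of $G$. *)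

theory Defs
  imports "Graph_Theory.Graph_Theory" "HOL-Library.Sublist"
begin

section \<open>Path-decompositions and the path-chromatic number\<close>

text \<open>
  Undirected graphs are symmetric loop-free digraphs, as in the library locales
  \<^locale>\<open>graph\<close> and \<^locale>\<open>pair_graph\<close>.
\<close>

definition proper_coloring :: "('a, 'b) pre_digraph \<Rightarrow> nat \<Rightarrow> ('a \<Rightarrow> nat) \<Rightarrow> bool" where
  "proper_coloring G k c \<longleftrightarrow>
     (\<forall>v \<in> verts G. c v < k) \<and> (\<forall>u v. u \<rightarrow>\<^bsub>G\<^esub> v \<longrightarrow> c u \<noteq> c v)"

definition chromatic_number :: "('a, 'b) pre_digraph \<Rightarrow> nat" where
  "chromatic_number G = (LEAST k. \<exists>c. proper_coloring G k c)"

text \<open>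
  The path underlying the decomposition has the vertices \<open>0, \<dots>, length Bs - 1\<close> in this order,
  and \<open>Bs ! t\<close> is the bag of \<open>t\<close>; the subpaths are exactly the sets of consecutive indices.
\<close>

definition path_decomposition :: "('a, 'b) pre_digraph \<Rightarrow> 'a set list \<Rightarrow> bool" where
  "path_decomposition G Bs \<longleftrightarrow>
     Bs \<noteq> [] \<and>
     (\<forall>B \<in> set Bs. B \<subseteq> verts G) \<and>
     (\<forall>v \<in> verts G. \<exists>B \<in> set Bs. v \<in> B) \<and>
     (\<forall>u v. u \<rightarrow>\<^bsub>G\<^esub> v \<longrightarrow> (\<exists>B \<in> set Bs. u \<in> B \<and> v \<in> B)) \<and>
     (\<forall>v \<in> verts G. \<exists>i j. {t. t < length Bs \<and> v \<in> Bs ! t} = {i..j})"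

definition decomposition_chromatic_number :: "('a, 'b) pre_digraph \<Rightarrow> 'a set list \<Rightarrow> nat" where
  "decomposition_chromatic_number G Bs = Max ((\<lambda>B. chromatic_number (G \<restriction> B)) ` set Bs)"

definition pchr :: "('a, 'b) pre_digraph \<Rightarrow> nat" where
  "pchr G = (LEAST k. \<exists>Bs. path_decomposition G Bs \<and> k = decomposition_chromatic_number G Bs)"


section \<open>The graph of V's in the complete binary tree\<close>

definition binary_tree :: "nat \<Rightarrow> bool list pair_pre_digraph" where
  "binary_tree n = \<lparr> pverts = {x. length x \<le> n},
     parcs = {(x, y). length x \<le> n \<and> length y \<le> n \<and> (\<exists>b. y = x @ [b] \<or> x = y @ [b])} \<rparr>"

text \<open>
  The path visiting the vertices of \<open>p\<close> in order, as an undirected graph; it does not depend on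
  the direction in which it is traversed.
\<close>

definition path_graph :: "'a list \<Rightarrow> 'a pair_pre_digraph" where
  "path_graph p = \<lparr> pverts = set p, parcs = set (vwalk_arcs p) \<union> (set (vwalk_arcs p))\<inverse> \<rparr>"

definition endpoints :: "'a pair_pre_digraph \<Rightarrow> 'a set" where
  "endpoints H = {v. \<exists>p. p \<noteq> [] \<and> distinct p \<and> H = path_graph p \<and> v \<in> {hd p, last p}}"

text \<open>The distance of a binary string from the root is its length.\<close>

definition low_point :: "bool list pair_pre_digraph \<Rightarrow> bool list" where
  "low_point H = (ARG_MIN length x. x \<in> pverts H)"

definition Vs :: "nat \<Rightarrow> bool list pair_pre_digraph set" where
  "Vs n = {path_graph p | p. vpath p (binary_tree n) \<and> hd p \<noteq> last p \<and>
             low_point (path_graph p) \<notin> {hd p, last p}}"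

definition V_graph :: "nat \<Rightarrow> bool list pair_pre_digraph pair_pre_digraph" where
  "V_graph n = \<lparr> pverts = Vs n,
     parcs = {(A, B). A \<in> Vs n \<and> B \<in> Vs n \<and>
                (low_point A \<in> endpoints B \<or> low_point B \<in> endpoints A)} \<rparr>"


section \<open>V's as triples of strings\<close>

lemma vwalk_arcs_conv: "set (vwalk_arcs p) = {(p ! i, p ! Suc i) | i. Suc i < length p}"
proof (induction p rule: vwalk_arcs.induct)
  case (3 x y xs)
  have "{((x # y # xs) ! i, (x # y # xs) ! Suc i) | i. Suc i < length (x # y # xs)} =
        insert (x, y) {((y # xs) ! i, (y # xs) ! Suc i) | i. Suc i < length (y # xs)}" (is "?L = ?R")
  proof (intro equalityI subsetI)
    fix e assume "e \<in> ?L"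
    then obtain i where i: "e = ((x # y # xs) ! i, (x # y # xs) ! Suc i)" "Suc i < length (x # y # xs)"
      by auto
    then show "e \<in> ?R" by (cases i) auto
  next
    fix e assume "e \<in> ?R"
    then consider "e = (x, y)" | i where "e = ((y # xs) ! i, (y # xs) ! Suc i)" "Suc i < length (y # xs)"
      by auto
    then show "e \<in> ?L"
    proof cases
      case 1
      then show ?thesis by (auto intro!: exI[of _ 0])
    next
      case (2 i)
      then show ?thesis by (auto intro!: exI[of _ "Suc i"])
    qed
  qed
  then show ?case using 3 by simp
qed auto

lemma path_graph_rev: "path_graph (rev p) = path_graph p"
proof -
  have sub: "set (vwalk_arcs (rev q)) \<subseteq> (set (vwalk_arcs q))\<inverse>" for q :: "'a list"
  proof
    fix e assume "e \<in> set (vwalk_arcs (rev q))"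
    then obtain i where i: "Suc i < length q" "e = (rev q ! i, rev q ! Suc i)"
      by (auto simp: vwalk_arcs_conv)
    let ?j = "length q - Suc (Suc i)"
    have "e = (q ! Suc ?j, q ! ?j)" "Suc ?j < length q"
      using i by (auto simp: rev_nth Suc_diff_Suc)
    then show "e \<in> (set (vwalk_arcs q))\<inverse>" by (auto simp: vwalk_arcs_conv)
  qed
  from sub[of p] sub[of "rev p"] have "set (vwalk_arcs (rev p)) = (set (vwalk_arcs p))\<inverse>" by auto
  then show ?thesis by (auto simp: path_graph_def)
qed

lemma endpoints_path_graph:
  assumes p: "p \<noteq> []" "distinct p"
  shows "endpoints (path_graph p) = {hd p, last p}"
proof -
  have hd_in: "hd q \<in> {hd p, last p}"
    if q: "q \<noteq> []" "distinct q" "path_graph p = path_graph q" for q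
  proof (rule ccontr)
    assume neg: "hd q \<notin> {hd p, last p}"
    have "hd q \<in> set p" using q by (auto simp: path_graph_def)
    then obtain i where i: "i < length p" "p ! i = hd q" by (auto simp: in_set_conv_nth)
    have "i \<noteq> 0" using neg i p by (metis hd_conv_nth insertI1)
    moreover have "i \<noteq> length p - 1" using neg i p by (metis insertI1 insertI2 last_conv_nth)
    ultimately have i0: "0 < i" "Suc i < length p" using i by linarith+
    have arc: "(p ! j, p ! Suc j) \<in> set (vwalk_arcs p)" if "Suc j < length p" for j
      using that unfolding vwalk_arcs_conv by blast
    have "(p ! (i - 1), hd q) \<in> set (vwalk_arcs p)" "(hd q, p ! Suc i) \<in> set (vwalk_arcs p)"
      using arc[of "i - 1"] arc[of i] i i0 by simp_all
    then have "(hd q, p ! (i - 1)) \<in> parcs (path_graph q)" "(hd q, p ! Suc i) \<in> parcs (path_graph q)"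
      using q(3) by (auto simp: path_graph_def)
    moreover have "w = q ! 1" if "(hd q, w) \<in> parcs (path_graph q)" for w
      using that q(1,2) by (auto simp: path_graph_def vwalk_arcs_conv hd_conv_nth nth_eq_iff_index_eq)
    ultimately have "p ! (i - 1) = p ! Suc i" by metis
    then show False using i0 p by (simp add: nth_eq_iff_index_eq)
  qed
  have "last q \<in> {hd p, last p}"
    if q: "q \<noteq> []" "distinct q" "path_graph p = path_graph q" for q
    using hd_in[of "rev q"] q by (simp add: path_graph_rev hd_rev)
  with hd_in have "endpoints (path_graph p) \<subseteq> {hd p, last p}" unfolding endpoints_def by blast
  moreover have "{hd p, last p} \<subseteq> endpoints (path_graph p)" unfolding endpoints_def using p by blast
  ultimately show ?thesis by blast
qed

fun chain :: "bool list \<Rightarrow> bool list \<Rightarrow> bool list list" where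
  "chain x [] = []"
| "chain x (b # w) = (x @ [b]) # chain (x @ [b]) w"

text \<open>For \<open>x0\<close> a prefix of \<open>y\<close> and \<open>x1\<close> a prefix of \<open>z\<close>, the path from \<open>y\<close> via \<open>x\<close> to \<open>z\<close>.\<close>

definition V_path :: "bool list \<times> bool list \<times> bool list \<Rightarrow> bool list list" where
  "V_path = (\<lambda>(x, y, z). rev (chain x (drop (length x) y)) @ x # chain x (drop (length x) z))"

definition V_triples :: "nat \<Rightarrow> (bool list \<times> bool list \<times> bool list) set" where
  "V_triples n = {(x, y, z). length y \<le> n \<and> length z \<le> n \<and>
      prefix (x @ [False]) y \<and> prefix (x @ [True]) z}"

lemma set_chain: "v \<in> set (chain x w) \<Longrightarrow> \<exists>u. u \<noteq> [] \<and> v = x @ u \<and> prefix u w"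
  by (induction x w rule: chain.induct) fastforce+

lemma distinct_chain: "distinct (chain x w)"
  by (induction x w rule: chain.induct) (auto dest!: set_chain)

lemma last_chain: "w \<noteq> [] \<Longrightarrow> last (chain x w) = x @ w \<and> chain x w \<noteq> []"
proof (induction x w rule: chain.induct)
  case (2 x b w)
  then show ?case by (cases w) auto
qed simp

lemma chain_walk:
  assumes "length x + length w \<le> n"
  shows "vwalk (x # chain x w) (with_proj (binary_tree n))"
  using assms
proof (induction x w rule: chain.induct)
  case (2 x b w)
  then have "vwalk ((x @ [b]) # chain (x @ [b]) w) (with_proj (binary_tree n))" by simp
  then show ?case using 2(2) by (auto simp: vwalk_def binary_tree_def)
qed (auto simp: vwalk_def binary_tree_def)

lemma sym_binary_tree: "(u, v) \<in> parcs (binary_tree n) \<longleftrightarrow> (v, u) \<in> parcs (binary_tree n)"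
  by (auto simp: binary_tree_def)

lemma binary_tree_graph: "pair_graph (binary_tree n)"
proof -
  have fin: "finite {x :: bool list. length x \<le> n}"
    using finite_lists_length_le[of "UNIV :: bool set" n] by simp
  have "parcs (binary_tree n) \<subseteq> {x. length x \<le> n} \<times> {x. length x \<le> n}"
    by (auto simp: binary_tree_def)
  then have "finite (parcs (binary_tree n))" using fin by (meson finite_SigmaI finite_subset)
  with fin show ?thesis
    by unfold_locales (auto simp: binary_tree_def symmetric_def sym_def)
qed

text \<open>A path that leaves its start downwards keeps going down.\<close>

lemma descending:
  assumes "vpath (a # (a @ [b]) # bs) (with_proj (binary_tree n))"
  shows "\<exists>w. (a @ [b]) # bs = chain a (b # w)"
  using assms
proof (induction bs arbitrary: a b)
  case Nil
  show ?case by (auto intro: exI[of _ "[]"])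
next
  case (Cons c bs)
  then have "(a @ [b], c) \<in> parcs (binary_tree n)" "c \<noteq> a"
    by (auto simp: vpath_def vwalk_def)
  then obtain d where d: "c = (a @ [b]) @ [d]" by (auto simp: binary_tree_def)
  have "vpath ((a @ [b]) # ((a @ [b]) @ [d]) # bs) (with_proj (binary_tree n))"
    using Cons.prems d by (auto simp: vpath_def vwalk_def)
  from Cons.IH[OF this] obtain w where "c # bs = chain (a @ [b]) (d # w)" using d by auto
  then show ?case by (auto intro!: exI[of _ "d # w"])
qed

lemma descending_min:
  assumes "vpath (x # bs) (with_proj (binary_tree n))" "bs \<noteq> []" "\<forall>v \<in> set bs. length x \<le> length v"
  shows "\<exists>b w. bs = chain x (b # w)"
proof -
  obtain c cs where bs: "bs = c # cs" using assms(2) by (cases bs) auto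
  have "(x, c) \<in> parcs (binary_tree n)" using assms(1) bs by (auto simp: vpath_def vwalk_def)
  moreover have "length x \<le> length c" using assms(3) bs by auto
  ultimately obtain b where "c = x @ [b]" by (auto simp: binary_tree_def)
  with descending[of x b cs n] assms(1) bs show ?thesis by blast
qed

lemma V_path_props:
  assumes "(x, y, z) \<in> V_triples n"
  defines "p \<equiv> V_path (x, y, z)"
  shows "vpath p (with_proj (binary_tree n))" "hd p = y" "last p = z" "p \<noteq> []"
    "low_point (path_graph p) = x" "endpoints (path_graph p) = {y, z}" "y \<noteq> z" "x \<noteq> y" "x \<noteq> z"
proof -
  from assms obtain u v where y: "y = x @ False # u" and z: "z = x @ True # v"
      and len: "length y \<le> n" "length z \<le> n"
    by (auto simp: V_triples_def prefix_def)
  let ?A = "chain x (False # u)" and ?B = "chain x (True # v)"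
  have p: "p = rev ?A @ x # ?B" by (simp add: p_def V_path_def y z)
  have disj: "set ?A \<inter> set ?B = {}" by (auto dest!: set_chain)
  have nx: "x \<notin> set ?A" "x \<notin> set ?B" by (auto dest!: set_chain)
  have dist: "distinct p" using disj nx distinct_chain[of x "False # u"] distinct_chain[of x "True # v"]
    by (auto simp: p)
  interpret pair_graph "binary_tree n" by (rule binary_tree_graph)
  have wA: "vwalk (x # ?A) (with_proj (binary_tree n))" using chain_walk[of x "False # u" n] len y by simp
  have wB: "vwalk (x # ?B) (with_proj (binary_tree n))" using chain_walk[of x "True # v" n] len z by simp
  have arcs: "(p ! i, p ! Suc i) \<in> parcs (binary_tree n)" if "Suc i < length p" for i
  proof (cases "i < length ?A")
    case True
    let ?j = "length ?A - Suc i"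
    have "p ! i = (x # ?A) ! Suc ?j" using True by (auto simp: p nth_append rev_nth)
    moreover have "p ! Suc i = (x # ?A) ! ?j"
      using True by (cases "Suc i < length ?A") (auto simp: p nth_append rev_nth nth_Cons' Suc_diff_Suc)
    moreover have "((x # ?A) ! ?j, (x # ?A) ! Suc ?j) \<in> set (vwalk_arcs (x # ?A))"
      using True unfolding vwalk_arcs_conv by fastforce
    ultimately show ?thesis using wA sym_binary_tree by (auto simp: vwalk_def)
  next
    case False
    let ?j = "i - length ?A"
    have "p ! i = (x # ?B) ! ?j" "p ! Suc i = (x # ?B) ! Suc ?j"
      using False by (auto simp: p nth_append Suc_diff_le)
    moreover have "((x # ?B) ! ?j, (x # ?B) ! Suc ?j) \<in> set (vwalk_arcs (x # ?B))"
      using False that unfolding vwalk_arcs_conv by (fastforce simp: p)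
    ultimately show ?thesis using wB by (auto simp: vwalk_def)
  qed
  have "set p \<subseteq> pverts (binary_tree n)" using wA wB by (auto simp: p vwalk_def)
  then show vp: "vpath p (with_proj (binary_tree n))"
    using arcs dist by (auto simp: vpath_def vwalk_def vwalk_arcs_conv p)
  show hd: "hd p = y" using last_chain[of "False # u" x] by (simp add: p y hd_append hd_rev del: chain.simps)
  show last: "last p = z" using last_chain[of "True # v" x] by (simp add: p z del: chain.simps)
  show ne: "p \<noteq> []" by (simp add: p)
  show "endpoints (path_graph p) = {y, z}" using endpoints_path_graph[OF ne dist] hd last by simp
  have "is_arg_min length (\<lambda>v. v \<in> set p) v \<longleftrightarrow> v = x" for v
  proof -
    have "x \<in> set p" "\<And>v. v \<in> set p \<Longrightarrow> v \<noteq> x \<Longrightarrow> length x < length v"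
      by (auto simp: p simp del: chain.simps dest!: set_chain)
    then show ?thesis by (auto simp: is_arg_min_def) (metis less_asym)
  qed
  then show "low_point (path_graph p) = x"
    by (simp add: low_point_def arg_min_def path_graph_def)
  show "y \<noteq> z" "x \<noteq> y" "x \<noteq> z" by (auto simp: y z)
qed

theorem Vs_triples: "bij_betw (\<lambda>t. path_graph (V_path t)) (V_triples n) (Vs n)"
proof (rule bij_betw_imageI)
  show "inj_on (\<lambda>t. path_graph (V_path t)) (V_triples n)"
  proof (rule inj_onI)
    fix t t'
    assume tt: "t \<in> V_triples n" "t' \<in> V_triples n" "path_graph (V_path t) = path_graph (V_path t')"
    obtain x y z x' y' z' where te: "t = (x, y, z)" "t' = (x', y', z')"
      by (metis prod_cases3)
    with tt have t: "(x, y, z) \<in> V_triples n" "(x', y', z') \<in> V_triples n"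
      and eq: "path_graph (V_path (x, y, z)) = path_graph (V_path (x', y', z'))"
      by simp_all
    have "x = x'" "{y, z} = {y', z'}"
      using V_path_props(5,6)[OF t(1)] V_path_props(5,6)[OF t(2)] eq by metis+
    moreover have "\<not> (y = z' \<and> z = y')" if "x = x'"
      using t that by (auto simp: V_triples_def prefix_def)
    ultimately show "t = t'" unfolding te by (auto simp: doubleton_eq_iff)
  qed
  show "(\<lambda>t. path_graph (V_path t)) ` V_triples n = Vs n"
  proof (intro equalityI subsetI)
    fix H assume "H \<in> (\<lambda>t. path_graph (V_path t)) ` V_triples n"
    then obtain x y z where t: "(x, y, z) \<in> V_triples n" and H: "H = path_graph (V_path (x, y, z))"
      by auto
    show "H \<in> Vs n" unfolding Vs_def H mem_Collect_eq
      by (rule exI[of _ "V_path (x, y, z)"]) (simp add: V_path_props[OF t])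
  next
    fix H assume "H \<in> Vs n"
    then obtain p where p: "vpath p (with_proj (binary_tree n))" "low_point (path_graph p) \<notin> {hd p, last p}"
      and H: "H = path_graph p" by (auto simp: Vs_def)
    interpret pair_graph "binary_tree n" by (rule binary_tree_graph)
    define x where "x = low_point (path_graph p)"
    have ne: "p \<noteq> []" using p by (auto simp: vpath_def vwalk_def)
    have "is_arg_min length (\<lambda>v. v \<in> set p) x"
      unfolding x_def low_point_def path_graph_def
      using ne arg_min_natI[of "\<lambda>v. v \<in> set p" "hd p" length]
        arg_min_nat_le[of "\<lambda>v. v \<in> set p" _ length]
      by (auto simp: is_arg_min_linorder)
    then have x: "x \<in> set p" and min: "\<And>v. v \<in> set p \<Longrightarrow> length x \<le> length v"
      by (auto simp: is_arg_min_linorder)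
    obtain as bs where pe: "p = as @ x # bs" using x by (meson split_list)
    have "x \<noteq> hd p" "x \<noteq> last p" using p(2) x_def by auto
    then have "as \<noteq> []" "bs \<noteq> []" by (auto simp: pe)
    have arc_app: "set (vwalk_arcs q) \<subseteq> set (vwalk_arcs (r @ q))" for q r :: "bool list list"
      unfolding vwalk_arcs_conv
    proof clarify
      fix i assume "Suc i < length q"
      then show "\<exists>j. (q ! i, q ! Suc i) = ((r @ q) ! j, (r @ q) ! Suc j) \<and> Suc j < length (r @ q)"
        by (intro exI[of _ "length r + i"]) (auto simp: nth_append)
    qed
    have pg: "set (vwalk_arcs q) \<subseteq> parcs (path_graph q)" "parcs (path_graph q) = parcs (path_graph (rev q))"
      for q :: "bool list list" by (simp_all add: path_graph_rev) (auto simp: path_graph_def)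
    have in_tree: "parcs (path_graph p) \<subseteq> parcs (binary_tree n)"
      using p(1) sym_binary_tree by (auto simp: path_graph_def vpath_def vwalk_def)
    have B: "vpath (x # bs) (with_proj (binary_tree n))"
      using p(1) arc_app[of "x # bs" as] by (auto simp: vpath_def vwalk_def pe)
    have "set (vwalk_arcs (x # rev as)) \<subseteq> set (vwalk_arcs (rev p))"
      using arc_app[of "x # rev as" "rev bs"] by (simp add: pe)
    also have "\<dots> \<subseteq> parcs (binary_tree n)" using pg(1)[of "rev p"] pg(2)[of p] in_tree by blast
    finally have A: "vpath (x # rev as) (with_proj (binary_tree n))"
      using p(1) by (auto simp: vpath_def vwalk_def pe)
    obtain b v where bs: "bs = chain x (b # v)"
      using descending_min[OF B \<open>bs \<noteq> []\<close>] min pe by auto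
    obtain a u where as: "rev as = chain x (a # u)"
      using descending_min[OF A] \<open>as \<noteq> []\<close> min pe by auto
    have "distinct (rev as @ bs)" using p(1) by (auto simp: vpath_def pe)
    then have ab: "a \<noteq> b" by (auto simp: as bs)
    have "set p \<subseteq> {x. length x \<le> n}" using p(1) by (auto simp: vpath_def vwalk_def binary_tree_def)
    moreover have "x @ a # u \<in> set p" "x @ b # v \<in> set p"
      using last_chain[of "a # u" x] last_chain[of "b # v" x] as bs
      by (metis Un_iff last_in_set list.distinct(1) list.set_intros(2) pe set_append set_rev)+
    ultimately have len: "length (x @ a # u) \<le> n" "length (x @ b # v) \<le> n" by auto
    have as': "as = rev (chain x (a # u))" using as by (metis rev_rev_ident)
    show "H \<in> (\<lambda>t. path_graph (V_path t)) ` V_triples n"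
    proof (cases a)
      case False
      then have "(x, x @ a # u, x @ b # v) \<in> V_triples n" "p = V_path (x, x @ a # u, x @ b # v)"
        using ab len by (auto simp: V_triples_def V_path_def pe as' bs prefix_def)
      then show ?thesis using H by auto
    next
      case True
      then have "(x, x @ b # v, x @ a # u) \<in> V_triples n" "rev p = V_path (x, x @ b # v, x @ a # u)"
        using ab len by (auto simp: V_triples_def V_path_def pe as' bs prefix_def)
      then show ?thesis using H path_graph_rev[of p] by (metis image_eqI)
    qed
  qed
qed

lemma V_graph_graph: "pair_graph (V_graph n)"
proof -
  have finl: "finite {x :: bool list. length x \<le> n}"
    using finite_lists_length_le[of "UNIV :: bool set" n] by simp
  have "V_triples n \<subseteq> {x. length x \<le> n} \<times> {x. length x \<le> n} \<times> {x. length x \<le> n}"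
    by (auto simp: V_triples_def prefix_def)
  then have "finite (V_triples n)" by (rule finite_subset) (intro finite_SigmaI finl)
  then have fin: "finite (Vs n)" using Vs_triples bij_betw_finite by blast
  have irr: "low_point A \<notin> endpoints A" if A: "A \<in> Vs n" for A
  proof -
    obtain p where "vpath p (with_proj (binary_tree n))" "low_point (path_graph p) \<notin> {hd p, last p}"
      "A = path_graph p" using A by (auto simp: Vs_def)
    then show ?thesis using endpoints_path_graph[of p] by (auto simp: vpath_def vwalk_def)
  qed
  have "parcs (V_graph n) \<subseteq> Vs n \<times> Vs n" by (auto simp: V_graph_def)
  then have "finite (parcs (V_graph n))" using fin by (meson finite_SigmaI finite_subset)
  with fin irr show ?thesis
    by unfold_locales (auto simp: V_graph_def symmetric_def sym_def)
qed

end

theory Submission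
  imports Defs
begin

text \<open>
  Number the vertices of the tree in the order of an in-order traversal. A V with endpoints \<open>y\<close>,
  \<open>z\<close> occupies the gaps between consecutive numbers that lie between \<open>y\<close> and \<open>z\<close>; its low point
  lies in this interval, so two adjacent V's occupy a common gap next to the low point of one of
  them. Within the bag of a fixed gap, colour each V according to the side of the gap on which its
  low point lies. If \<open>y\<close> is also the low point of another V in the bag, then \<open>y\<close> is before the gap
  while the other V, and hence the gap, lies entirely before the low point of the first V;
  symmetrically for \<open>z\<close>. So the colouring is proper.
\<close>

text \<open>In depth \<open>m\<close> the numbers run from 1 to \<open>2 ^ (m + 1) - 1\<close>: the
  left subtree fills those below the root's \<open>2 ^ m\<close>, and the right subtree repeats them
  shifted by \<open>2 ^ m\<close>.\<close>

fun inorder_index :: "nat \<Rightarrow> bool list \<Rightarrow> nat" where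
  "inorder_index m [] = 2 ^ m"
| "inorder_index m (b # w) = (if b then 2 ^ m else 0) + inorder_index (m - 1) w"

lemma inorder_index_pos: "0 < inorder_index m w"
  by (induction m w rule: inorder_index.induct) auto

lemma inorder_index_less: "length w \<le> m \<Longrightarrow> inorder_index m w < 2 ^ Suc m"
proof (induction m w rule: inorder_index.induct)
  case (2 m b w)
  then show ?case by (cases m) auto
qed simp

lemma inorder_index_left:
  "prefix (x @ [False]) u \<Longrightarrow> length u \<le> m \<Longrightarrow> inorder_index m u < inorder_index m x"
proof (induction x arbitrary: m u)
  case Nil
  then obtain w where "u = False # w" by (auto simp: prefix_def)
  \<comment> \<open>The length bound forces \<open>m > 0\<close>, so the left subtree has depth
    \<open>m - 1\<close> and its numbers stay below the root's \<open>2 ^ m\<close>.\<close>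
  with Nil show ?case using inorder_index_less[of w "m - 1"] by (cases m) auto
next
  case (Cons b x)
  then obtain w where w: "u = b # w" "prefix (x @ [False]) w" by (auto simp: prefix_def)
  with Cons.IH[of w "m - 1"] Cons.prems show ?case by auto
qed

lemma inorder_index_right:
  "prefix (x @ [True]) u \<Longrightarrow> inorder_index m x < inorder_index m u"
proof (induction x arbitrary: m u)
  case Nil
  then show ?case using inorder_index_pos by (auto simp: prefix_def)
next
  case (Cons b x)
  then obtain w where w: "u = b # w" "prefix (x @ [True]) w" by (auto simp: prefix_def)
  with Cons.IH[of w "m - 1"] show ?case by auto
qed

lemma V_triples_inorder:
  assumes "(x, y, z) \<in> V_triples n"
  shows "inorder_index n y < inorder_index n x" "inorder_index n x < inorder_index n z"
    "inorder_index n z < 2 ^ Suc n"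
  using assms inorder_index_left inorder_index_right inorder_index_less
  by (auto simp: V_triples_def)

abbreviation V_of :: "bool list \<times> bool list \<times> bool list \<Rightarrow> bool list pair_pre_digraph" where
  "V_of t \<equiv> path_graph (V_path t)"

lemma Vs_cases:
  assumes "A \<in> Vs n"
  obtains x y z where "(x, y, z) \<in> V_triples n" "A = V_of (x, y, z)"
proof -
  have "A \<in> V_of ` V_triples n" using assms Vs_triples[of n] by (simp add: bij_betw_def)
  then show ?thesis using that by auto
qed

lemma V_of_in_Vs: "t \<in> V_triples n \<Longrightarrow> V_of t \<in> Vs n"
  using Vs_triples[of n] by (auto simp: bij_betw_def)

text \<open>The bag of the gap between the numbers \<open>k\<close> and \<open>k + 1\<close>.\<close>

definition gap_bag :: "nat \<Rightarrow> nat \<Rightarrow> bool list pair_pre_digraph set" where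
  "gap_bag n k = V_of ` {(x, y, z) \<in> V_triples n. inorder_index n y \<le> k \<and> k < inorder_index n z}"

text \<open>As \<open>gap_bag\<close> is an image, this rests on injectivity: no other triple yields
  the same path.\<close>

lemma V_of_in_gap_bag:
  assumes "(x, y, z) \<in> V_triples n"
  shows "V_of (x, y, z) \<in> gap_bag n k \<longleftrightarrow> inorder_index n y \<le> k \<and> k < inorder_index n z"
proof -
  have "inj_on V_of (V_triples n)" using Vs_triples by (auto simp: bij_betw_def)
  then show ?thesis using assms unfolding gap_bag_def by (subst inj_on_image_mem_iff) auto
qed

lemma gap_bag_subset: "gap_bag n k \<subseteq> Vs n"
  using V_of_in_Vs by (auto simp: gap_bag_def)

lemma V_graph_dominates:
  "A \<rightarrow>\<^bsub>with_proj (V_graph n)\<^esub> B \<longleftrightarrow>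
     A \<in> Vs n \<and> B \<in> Vs n \<and> (low_point A \<in> endpoints B \<or> low_point B \<in> endpoints A)"
  by (auto simp: V_graph_def arcs_ends_def arc_to_ends_def)

lemma adjacent_in_common_gap_bag:
  assumes "A \<in> Vs n" "B \<in> Vs n" "low_point B \<in> endpoints A"
  shows "\<exists>k < 2 ^ Suc n. A \<in> gap_bag n k \<and> B \<in> gap_bag n k"
proof -
  obtain x y z where A: "(x, y, z) \<in> V_triples n" "A = V_of (x, y, z)"
    using assms(1) by (rule Vs_cases)
  obtain x' y' z' where B: "(x', y', z') \<in> V_triples n" "B = V_of (x', y', z')"
    using assms(2) by (rule Vs_cases)
  note ord = V_triples_inorder[OF A(1)] V_triples_inorder[OF B(1)]
  have "x' = y \<or> x' = z" using assms(3) A B V_path_props(5,6) by auto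
  then show ?thesis
  proof
    assume "x' = y"
    \<comment> \<open>The gap just after \<open>y\<close> is the first one of \<open>A\<close>;
      being the low point of \<open>B\<close>, \<open>y\<close> lies strictly between
      \<open>y'\<close> and \<open>z'\<close>.\<close>
    with ord show ?thesis unfolding A(2) B(2) V_of_in_gap_bag[OF A(1)] V_of_in_gap_bag[OF B(1)]
      by (intro exI[of _ "inorder_index n y"]) auto
  next
    assume "x' = z"
    \<comment> \<open>The gap just before \<open>z\<close> is the last one of \<open>A\<close>;
      \<open>B\<close> occupies it because \<open>y'\<close> comes before
      \<open>x' = z\<close>.\<close>
    with ord show ?thesis unfolding A(2) B(2) V_of_in_gap_bag[OF A(1)] V_of_in_gap_bag[OF B(1)]
      by (intro exI[of _ "inorder_index n z - 1"]) auto
  qed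
qed

lemma path_decomposition_gap_bags:
  "path_decomposition (with_proj (V_graph n)) (map (gap_bag n) [0..<2 ^ Suc n])"
  unfolding path_decomposition_def
proof (intro conjI ballI allI impI)
  show "map (gap_bag n) [0..<2 ^ Suc n] \<noteq> []" by simp
next
  fix B assume "B \<in> set (map (gap_bag n) [0..<2 ^ Suc n])"
  then show "B \<subseteq> verts (with_proj (V_graph n))"
    using gap_bag_subset by (fastforce simp: V_graph_def)
next
  fix A assume "A \<in> verts (with_proj (V_graph n))"
  then have "A \<in> Vs n" by (simp add: V_graph_def)
  then obtain x y z where A: "(x, y, z) \<in> V_triples n" "A = V_of (x, y, z)" by (rule Vs_cases)
  note ord = V_triples_inorder[OF A(1)]
  have "A \<in> gap_bag n (inorder_index n y)" using ord by (simp add: A V_of_in_gap_bag)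
  moreover have "inorder_index n y \<in> {0..<2 ^ Suc n}" using ord by simp
  ultimately show "\<exists>B \<in> set (map (gap_bag n) [0..<2 ^ Suc n]). A \<in> B"
    unfolding set_map set_upt by blast
  \<comment> \<open>Subtracting 1 is safe since \<open>z\<close> has a positive number, and that
    number is below \<open>2 ^ Suc n\<close>, so the list of bags does not cut the interval
    short.\<close>
  have "{t. t < length (map (gap_bag n) [0..<2 ^ Suc n]) \<and> A \<in> map (gap_bag n) [0..<2 ^ Suc n] ! t} =
      {inorder_index n y..inorder_index n z - 1}"
    using ord by (auto simp: A V_of_in_gap_bag simp del: upt_Suc power_Suc)
  then show "\<exists>i j. {t. t < length (map (gap_bag n) [0..<2 ^ Suc n]) \<and>
      A \<in> map (gap_bag n) [0..<2 ^ Suc n] ! t} = {i..j}" by blast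
next
  fix A B assume "A \<rightarrow>\<^bsub>with_proj (V_graph n)\<^esub> B"
  then obtain k where "k < 2 ^ Suc n" "A \<in> gap_bag n k" "B \<in> gap_bag n k"
    unfolding V_graph_dominates using adjacent_in_common_gap_bag by metis
  moreover from this have "k \<in> {0..<2 ^ Suc n}" by simp
  ultimately show "\<exists>C \<in> set (map (gap_bag n) [0..<2 ^ Suc n]). A \<in> C \<and> B \<in> C"
    unfolding set_map set_upt by blast
qed

lemma low_points_separated_by_gap:
  assumes "A \<in> gap_bag n k" "B \<in> gap_bag n k" "low_point B \<in> endpoints A"
  shows "inorder_index n (low_point A) \<le> k \<longleftrightarrow> \<not> inorder_index n (low_point B) \<le> k"
proof -
  obtain x y z where A: "(x, y, z) \<in> V_triples n" "A = V_of (x, y, z)"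
    and Ak: "inorder_index n y \<le> k" "k < inorder_index n z"
    using assms(1) by (auto simp: gap_bag_def)
  obtain x' y' z' where B: "(x', y', z') \<in> V_triples n" "B = V_of (x', y', z')"
    and Bk: "inorder_index n y' \<le> k" "k < inorder_index n z'"
    using assms(2) by (auto simp: gap_bag_def)
  have low: "low_point A = x" "low_point B = x'" using A B V_path_props(5) by auto
  have pre: "prefix (x @ [False]) y" "prefix (x @ [True]) z" "prefix x' y'" "prefix x' z'"
    "length z' \<le> n"
    using A(1) B(1) by (auto simp: V_triples_def dest: append_prefixD)
  have "x' = y \<or> x' = z" using assms(3) A B V_path_props(5,6) by auto
  then show ?thesis
  proof
    assume x': "x' = y"
    \<comment> \<open>All of \<open>B\<close> lies in the subtree of \<open>y\<close>, hence in the
      left subtree of \<open>x\<close>; the gap precedes \<open>z'\<close>, which precedes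
      \<open>x\<close>.\<close>
    then have "prefix (x @ [False]) z'" using pre prefix_order.trans by blast
    then have "inorder_index n z' < inorder_index n x" using inorder_index_left pre(5) by blast
    then show ?thesis using x' Ak Bk low by auto
  next
    assume x': "x' = z"
    \<comment> \<open>Mirror image: \<open>B\<close> lies in the right subtree of \<open>x\<close>,
      so \<open>x\<close> comes before \<open>y'\<close> and thus before the gap.\<close>
    then have "prefix (x @ [True]) y'" using pre prefix_order.trans by blast
    then have "inorder_index n x < inorder_index n y'" by (rule inorder_index_right)
    then show ?thesis using x' Ak Bk low by auto
  qed
qed

lemma chromatic_number_gap_bag: "chromatic_number (with_proj (V_graph n) \<restriction> gap_bag n k) \<le> 2"
proof -
  let ?c = "\<lambda>A. if inorder_index n (low_point A) \<le> k then 1 else 0 :: nat"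
  have "?c A \<noteq> ?c B" if "A \<rightarrow>\<^bsub>with_proj (V_graph n) \<restriction> gap_bag n k\<^esub> B" for A B
  proof -
    have "A \<in> gap_bag n k" "B \<in> gap_bag n k" "A \<rightarrow>\<^bsub>with_proj (V_graph n)\<^esub> B"
      using that by (auto simp: arcs_ends_def arc_to_ends_def induce_subgraph_def)
    \<comment> \<open>Either V may contribute the endpoint, so the separation is applied in both
      orders.\<close>
    then show ?thesis unfolding V_graph_dominates
      using low_points_separated_by_gap[of A n k B] low_points_separated_by_gap[of B n k A] by auto
  qed
  then have "proper_coloring (with_proj (V_graph n) \<restriction> gap_bag n k) 2 ?c"
    unfolding proper_coloring_def by auto
  then show ?thesis unfolding chromatic_number_def by (intro Least_le) blast
qed

theorem theorem2:
  fixes n :: nat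
  assumes "n \<ge> 1"
  shows "pchr (V_graph n) \<le> 2"
proof -
  let ?Bs = "map (gap_bag n) [0..<2 ^ Suc n]"
  have "pchr (V_graph n) \<le> decomposition_chromatic_number (V_graph n) ?Bs"
    unfolding pchr_def using path_decomposition_gap_bags by (intro Least_le) blast
  also have "\<dots> \<le> 2"
    unfolding decomposition_chromatic_number_def using chromatic_number_gap_bag
    by (subst Max_le_iff) auto
  finally show ?thesis .
qed

end
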